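(* Let $p>1$, $s\in(0,1)$, $\gamma_*>0$, let $E\subset\mathbb{R}^N$ be a bounded open set, and let $u\in\mathrm{DG}^{s,p}_-(E;\gamma_* )$ be non-negative in $K_R(x_o)\subset E$. There exists a constant $\eta\in(0,1)$ depending only on $\{s,p,N,\gamma_*\}$, such that $$\operatorname*{ess\,inf}_{K_{\frac12\varrho}(x_o)}u+\Big(\frac{\varrho}{R}\Big)^{\frac{sp}{p-1}}\mathrm{Tail}[u_-;K_R(x_o)]\ge\eta\,\mathrm{Tail}[u_+;K_\varrho(x_o)],$$ provided that $K_{2\varrho}(x_o)\subset K_R(x_o)$.
   Context: $K_R(x_o)$ denotes the ball in $\mathbb{R}^N$ of radius $R$ and center $x_o$; $v_\pm=\max\{\pm v,0\}$. The tail is $$\mathrm{Tail}[u;K_R(x_o)]:=\Big(R^{sp}\int_{\mathbb{R}^N\setminus K_R(x_o)}\frac{|u(x)|^{p-1}}{|x-x_o|^{N+sp}}\,\mathrm{d}x\Big)^{\frac{1}{p-1}}.$$ Definition (fractional DeGiorgi class). A measurable function $u:\mathbb{R}^N\to\mathbb{R}$ belongs to $\mathrm{DG}^{s,p}_-(E;\gamma_* )$ if $u\in W^{s,p}_{\rm loc}(E)$, $$\int_{\mathbb{R}^N}\frac{|u(x)|^{p-1}}{1+|x|^{N+sp}}\,\mathrm{d}x<\infty,$$ and for all concentric balls $K_r(x_o)\subset K_R(x_o)\subset E$ (with $r<R$) and every $k\in\mathbb{R}$, writing $w_\pm:=(u-k)_\pm$, $$\int_{K_r(x_o)}\int_{K_r(x_o)}\frac{|w_-(x)-w_-(y)|^p}{|x-y|^{N+sp}}\,\mathrm{d}y\,\mathrm{d}x+\int_{K_r(x_o)}\int_{\mathbb{R}^N}\frac{w_-(x)w_+^{p-1}(y)}{|x-y|^{N+sp}}\,\mathrm{d}y\,\mathrm{d}x$$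 $$\le\frac{\gamma_*R^{(1-s)p}}{(R-r)^p}\int_{K_R(x_o)}w_-^p\,\mathrm{d}x+\frac{\gamma_*R^N}{(R-r)^{N+sp}}\int_{K_R(x_o)}w_-\,\mathrm{d}x\,\big[\mathrm{Tail}[w_-;K_R(x_o)]\big]^{p-1}.$$ *)

theory Defs
  imports "HOL-Probability.Essential_Supremum"
begin

definition pos_part :: "real \<Rightarrow> real" where
  "pos_part v = max v 0"

definition neg_part :: "real \<Rightarrow> real" where
  "neg_part v = max (- v) 0"

text \<open>Only meant for exponents \<open>a > 0\<close>.\<close>

definition ennpowr :: "ennreal \<Rightarrow> real \<Rightarrow> ennreal" where
  "ennpowr c a = (if c = \<infinity> then \<infinity> else ennreal (enn2real c powr a))"

text \<open>All balls are open, measurability is Lebesgue measurability, and every integral is taken in \<^typ>\<open>ennreal\<close>, so that divergent integrals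
  have the value \<open>\<infinity>\<close>. This matters in the energy inequality below: a ball that touches the
  boundary of \<open>E\<close> is admissible, and the right-hand side may then be infinite.
  In the double integrals, \<open>x / 0 = 0\<close> only affects the diagonal, a null set.\<close>

definition Tail :: "real \<Rightarrow> real \<Rightarrow> ('a::euclidean_space \<Rightarrow> real) \<Rightarrow> 'a \<Rightarrow> real \<Rightarrow> ennreal" where
  "Tail s p u x0 R =
     ennpowr
       (ennreal (R powr (s * p)) *
        (\<integral>\<^sup>+x\<in>- ball x0 R.
           ennreal (\<bar>u x\<bar> powr (p - 1) / norm (x - x0) powr (real DIM('a) + s * p)) \<partial>lebesgue))
       (1 / (p - 1))"

definition gagliardo_energy :: "real \<Rightarrow> real \<Rightarrow> 'a::euclidean_space set \<Rightarrow> ('a \<Rightarrow> real) \<Rightarrow> ennreal" where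
  "gagliardo_energy s p A u =
     (\<integral>\<^sup>+x\<in>A. (\<integral>\<^sup>+y\<in>A.
        ennreal (\<bar>u x - u y\<bar> powr p / norm (x - y) powr (real DIM('a) + s * p)) \<partial>lebesgue) \<partial>lebesgue)"

definition frac_sobolev :: "real \<Rightarrow> real \<Rightarrow> 'a::euclidean_space set \<Rightarrow> ('a \<Rightarrow> real) set" where
  "frac_sobolev s p A =
     {u. u \<in> borel_measurable (lebesgue_on A) \<and>
         (\<integral>\<^sup>+x\<in>A. ennreal (\<bar>u x\<bar> powr p) \<partial>lebesgue) < \<infinity> \<and>
         gagliardo_energy s p A u < \<infinity>}"

definition frac_sobolev_loc :: "real \<Rightarrow> real \<Rightarrow> 'a::euclidean_space set \<Rightarrow> ('a \<Rightarrow> real) set" where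
  "frac_sobolev_loc s p E =
     {u. \<forall>A. open A \<and> compact (closure A) \<and> closure A \<subseteq> E \<longrightarrow> u \<in> frac_sobolev s p A}"

definition DG_minus :: "real \<Rightarrow> real \<Rightarrow> 'a::euclidean_space set \<Rightarrow> real \<Rightarrow> ('a \<Rightarrow> real) set" where
  "DG_minus s p E \<gamma> =
     {u. u \<in> borel_measurable lebesgue \<and>
         u \<in> frac_sobolev_loc s p E \<and>
         (\<integral>\<^sup>+x. ennreal (\<bar>u x\<bar> powr (p - 1) / (1 + norm x powr (real DIM('a) + s * p))) \<partial>lebesgue) < \<infinity> \<and>
         (\<forall>x0 r R k. 0 < r \<and> r < R \<and> ball x0 R \<subseteq> E \<longrightarrow>
           (let wm = (\<lambda>x. neg_part (u x - k)); wp = (\<lambda>x. pos_part (u x - k)) in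
             gagliardo_energy s p (ball x0 r) wm +
             (\<integral>\<^sup>+x\<in>ball x0 r. (\<integral>\<^sup>+y.
                ennreal (wm x * wp y powr (p - 1) / norm (x - y) powr (real DIM('a) + s * p))
                \<partial>lebesgue) \<partial>lebesgue)
             \<le> ennreal (\<gamma> * R powr ((1 - s) * p) / (R - r) powr p) *
                 (\<integral>\<^sup>+x\<in>ball x0 R. ennreal (wm x powr p) \<partial>lebesgue)
               + ennreal (\<gamma> * R ^ DIM('a) / (R - r) powr (real DIM('a) + s * p)) *
                 (\<integral>\<^sup>+x\<in>ball x0 R. ennreal (wm x) \<partial>lebesgue) *
                 ennpowr (Tail s p wm x0 R) (p - 1)))}"

definition ess_inf_on :: "'a::euclidean_space set \<Rightarrow> ('a \<Rightarrow> real) \<Rightarrow> ereal" where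
  "ess_inf_on A u = - esssup (lebesgue_on A) (\<lambda>x. - ereal (u x))"

end

theory Submission
  imports Defs
begin

text \<open>
  The proof is a DeGiorgi iteration in which the second integral on the left of the energy
  inequality, coupling w_-(x) = (u(x) - k)_- with w_+(y) = (u(y) - k)_+, takes the place of the
  fractional Sobolev embedding.

  Write q = N + sp and let L be a level above the tail of u_-, rescaled to the radius rho. On the
  ball of radius R the truncations w_- are at most L, and outside it they are at most L + u_-; so
  for levels k \<le> L the right side of the energy inequality is at most a constant times
  rho^(-sp) (rho / (r' - r))^(N + p) L^p |{u < k} \<inter> K_r'| (lemma \<open>mixed_energy_le\<close>). The mixed term
  on the left is then bounded below in two ways.

  Far away: for x in K_r with r = 3 rho / 4 and y outside K_rho the kernel |x - y|^(-q) is
  comparable to |y - x0|^(-q), and the inner integral is comparable to the tail of (u - L)_+. If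
  the tail of u_+ is a large multiple of L, then the set where u < L/2 takes up only a small
  part of K_r (lemma \<open>sublevel_small_of_large_tail\<close>).

  Nearby: if {u < k} covers at most half of the volume of a ball of radius t, then around each
  point x with u(x) < k' < k at least half of K_t(x) satisfies u \<ge> k, and the inner integral is at
  least of order t^N t^(-q) = t^(-sp). A sparse sublevel set permits a small t, hence a large
  factor t^(-sp) in front of |{u < k'}| (lemma \<open>sublevel_step\<close>). Along levels decreasing from L/2
  to L/4 and radii decreasing from 3 rho / 4 to rho / 2 this gain beats the geometric
  losses in the energy inequality as soon as the first set is small enough, and the measures tend to 0
  (lemma \<open>lower_bound_of_small_sublevel\<close>).

  Together: if the tail of u_+ exceeds a fixed multiple of L, then u \<ge> L/4 almost everywhere on
  the ball of radius rho / 2 (lemma \<open>lower_bound_of_large_tail\<close>). If the claimed inequality failed,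
  a number k strictly between its two sides would dominate the rescaled tail of u_- and be small
  compared with the tail of u_+; taking L = 4k gives u \<ge> k on that ball, although k exceeds the
  essential infimum.
\<close>

section \<open>Powers and integrals\<close>

lemma ennpowr_inverse:
  assumes "a > 0"
  shows "ennpowr (ennpowr c (1 / a)) a = c"
proof (cases "c = \<infinity>")
  case False
  then show ?thesis using assms
    by (auto simp: ennpowr_def powr_powr less_top)
qed (simp add: ennpowr_def)

lemma ennpowr_mono:
  assumes "a > 0" "c \<le> d"
  shows "ennpowr c a \<le> ennpowr d a"
proof (cases "d = \<infinity>")
  case False
  then have "c \<noteq> \<infinity>" using assms(2) by (auto simp: top_unique)
  moreover have "enn2real c \<le> enn2real d"
    using assms(2) False by (intro enn2real_mono) (auto simp: less_top)
  ultimately show ?thesis using False assms(1)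
    by (auto simp: ennpowr_def intro!: ennreal_leI powr_mono2)
qed (simp add: ennpowr_def)

lemma ennpowr_ennreal: "x \<ge> 0 \<Longrightarrow> ennpowr (ennreal x) a = ennreal (x powr a)"
  by (simp add: ennpowr_def)

lemma ennpowr_cmult:
  assumes "x > 0"
  shows "ennpowr (ennreal x * c) a = ennreal (x powr a) * ennpowr c a"
  using assms
  by (auto simp: ennpowr_def ennreal_mult_eq_top_iff ennreal_mult_top enn2real_mult powr_mult ennreal_mult)

lemma powr_add_le:
  fixes a b e :: real
  assumes "0 \<le> a" "0 \<le> b" "0 < e"
  shows "(a + b) powr e \<le> 2 powr e * (a powr e + b powr e)"
proof -
  have "(a + b) powr e \<le> (2 * max a b) powr e"
    using assms by (intro powr_mono2) auto
  also have "\<dots> = 2 powr e * max a b powr e"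
    using assms by (simp add: powr_mult)
  also have "max a b powr e \<le> a powr e + b powr e"
    by (auto simp: max_def)
  finally show ?thesis by simp
qed

lemma emeasure_lebesgue_ball:
  fixes c :: "'a::euclidean_space"
  assumes "r \<ge> 0"
  shows "emeasure lebesgue (ball c r) = ennreal (unit_ball_vol DIM('a) * r ^ DIM('a))"
  using emeasure_ball[OF assms, of c] by simp

text \<open>The sum of the geometric series that arises when |x|^(-n-\<sigma>) is integrated over the
  complement of the unit ball, with the bounds 2^(-j(n+\<sigma>)) for the kernel and
  \<open>unit_ball_vol n * 2^((j+1)n)\<close> for the volume of the j-th dyadic shell.\<close>

definition kernel_const :: "nat \<Rightarrow> real \<Rightarrow> real" where
  "kernel_const n \<sigma> = unit_ball_vol n * 2 ^ n / (1 - 2 powr - \<sigma>)"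

lemma kernel_const_pos: "\<sigma> > 0 \<Longrightarrow> kernel_const n \<sigma> > 0"
  unfolding kernel_const_def by (intro divide_pos_pos mult_pos_pos) (auto simp: powr_less_one)

text \<open>On the shell 2^j r \<le> |x - x0| < 2^(j+1) r the kernel is at most (2^j r)^(-N-\<sigma>), whereas the
  volume is at most that of the ball of radius 2^(j+1) r. So the shell contributes a multiple of
  (2^j r)^(-\<sigma>), which is summable because \<sigma> > 0.\<close>

lemma kernel_integral_outside_ball:
  fixes x0 :: "'a::euclidean_space" and r \<sigma> :: real
  assumes r: "r > 0" and \<sigma>: "\<sigma> > 0"
  shows "(\<integral>\<^sup>+x\<in>- ball x0 r. ennreal (1 / norm (x - x0) powr (DIM('a) + \<sigma>)) \<partial>lebesgue)
         \<le> ennreal (kernel_const DIM('a) \<sigma> * r powr - \<sigma>)"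
proof -
  let ?N = "DIM('a)" and ?q = "real DIM('a) + \<sigma>"
  define z :: real where "z = 2 powr - \<sigma>"
  have z: "0 < z" "z < 1" using \<sigma> by (auto simp: z_def powr_less_one)
  define K where "K = unit_ball_vol ?N * 2 ^ ?N * r powr - \<sigma>"
  have K: "K \<ge> 0" by (simp add: K_def)
  define f where "f j x = ennreal (1 / (2 ^ j * r) powr ?q) * indicator (ball x0 (2 ^ Suc j * r)) x"
    for j :: nat and x
  have pointwise: "ennreal (1 / norm (x - x0) powr ?q) * indicator (- ball x0 r) x \<le> (\<Sum>j. f j x)" for x
  proof (cases "x \<in> - ball x0 r")
    case True
    define d where "d = norm (x - x0)"
    have d: "d \<ge> r" using True by (simp add: d_def dist_norm norm_minus_commute)
    (* the index of the shell that contains x *)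
    define j where "j = nat \<lfloor>log 2 (d / r)\<rfloor>"
    have dr: "d / r \<ge> 1" using d r by simp
    then have l: "log 2 (d / r) \<ge> 0" by simp
    then have j: "real j \<le> log 2 (d / r)" "log 2 (d / r) < real j + 1"
      unfolding j_def by linarith+
    have "2 powr real j \<le> d / r" using j(1) dr by (simp add: le_log_iff)
    then have lo: "2 ^ j * r \<le> d" using r by (simp add: powr_realpow field_simps)
    have "d / r < 2 powr (real j + 1)" using j(2) dr by (simp add: log_less_iff)
    then have hi: "d < 2 ^ Suc j * r" using r by (simp add: powr_realpow powr_add field_simps)
    have "1 / d powr ?q \<le> 1 / (2 ^ j * r) powr ?q"
      using lo r \<sigma> d by (intro divide_left_mono powr_mono2 mult_pos_pos) auto
    then have "ennreal (1 / d powr ?q) \<le> f j x"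
      using hi by (simp add: f_def d_def dist_norm norm_minus_commute ennreal_leI)
    also have "\<dots> \<le> (\<Sum>j. f j x)" using sum_le_suminf[of "\<lambda>j. f j x" "{j}"] by simp
    finally show ?thesis using True by (simp add: d_def)
  qed simp
  have meas: "f j \<in> borel_measurable lebesgue" for j
    unfolding f_def by (intro borel_measurable_times_ennreal borel_measurable_const borel_measurable_indicator) auto
  have int_f: "integral\<^sup>N lebesgue (f j) = ennreal (K * z ^ j)" for j
  proof -
    have "integral\<^sup>N lebesgue (f j) = ennreal (1 / (2 ^ j * r) powr ?q) * emeasure lebesgue (ball x0 (2 ^ Suc j * r))"
      unfolding f_def by (subst nn_integral_cmult_indicator) auto
    also have "\<dots> = ennreal (1 / (2 ^ j * r) powr ?q * (unit_ball_vol ?N * (2 ^ Suc j * r) ^ ?N))"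
      using r by (subst emeasure_lebesgue_ball, simp, subst ennreal_mult) simp_all
    also have "1 / (2 ^ j * r) powr ?q * (unit_ball_vol ?N * (2 ^ Suc j * r) ^ ?N) = K * z ^ j"
    proof -
      have "(2 ^ j * r) powr ?q = (2 ^ j * r) ^ ?N * ((2 ^ j) powr \<sigma> * r powr \<sigma>)"
        using r by (simp add: powr_add powr_realpow powr_mult power_mult_distrib)
      moreover have "z ^ j = 1 / (2 ^ j) powr \<sigma>"
        by (simp add: z_def powr_minus powr_realpow[symmetric] powr_powr mult.commute inverse_eq_divide power_one_over)
      ultimately show ?thesis using r
        by (simp add: K_def powr_minus field_simps power_mult_distrib)
    qed
    finally show ?thesis .
  qed
  have "(\<integral>\<^sup>+x\<in>- ball x0 r. ennreal (1 / norm (x - x0) powr ?q) \<partial>lebesgue) \<le> (\<integral>\<^sup>+x. (\<Sum>j. f j x) \<partial>lebesgue)"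
    using pointwise by (intro nn_integral_mono) auto
  also have "\<dots> = (\<Sum>j. ennreal (K * z ^ j))"
    using meas by (simp add: nn_integral_suminf int_f)
  also have "\<dots> = ennreal (K * (1 / (1 - z)))"
    using z K by (intro suminf_ennreal_eq sums_mult geometric_sums) auto
  also have "K * (1 / (1 - z)) = kernel_const ?N \<sigma> * r powr - \<sigma>"
    by (simp add: K_def kernel_const_def z_def)
  finally show ?thesis .
qed

section \<open>The energy inequality below a level that dominates the negative tail\<close>

text \<open>The two summands in the last factor come from the two terms on the right of the energy
  inequality, the second one carrying the bound for the tail of w_-. The factor 2^(sp) allows
  radii between \<rho>/2 and \<rho>.\<close>

definition energy_const :: "nat \<Rightarrow> real \<Rightarrow> real \<Rightarrow> real \<Rightarrow> real" where
  "energy_const n s p \<gamma> = \<gamma> * 2 powr (s * p) * (1 + 2 powr (p - 1) * (1 + kernel_const n (s * p)))"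

lemma energy_const_pos:
  assumes "0 < s" "1 < p" "0 < \<gamma>"
  shows "energy_const n s p \<gamma> > 0"
  using assms kernel_const_pos[of "s * p" n] unfolding energy_const_def
  by (intro mult_pos_pos add_pos_pos) auto

lemma lebesgue_measurable_ident [measurable]: "(\<lambda>x::'a::euclidean_space. x) \<in> borel_measurable lebesgue"
  by (rule measurable_completion) simp

lemma lebesgue_measurable_ball [measurable]:
  "ball c r \<in> sets (lebesgue :: 'a::euclidean_space measure)"
  "- ball c r \<in> sets (lebesgue :: 'a::euclidean_space measure)"
  using borel_comp[of "ball c r"] by simp_all

lemma neg_part_nonneg [simp]: "neg_part v \<ge> 0"
  and pos_part_nonneg [simp]: "pos_part v \<ge> 0"
  by (auto simp: neg_part_def pos_part_def)

lemma borel_measurable_parts [measurable]: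
  "neg_part \<in> borel_measurable borel" "pos_part \<in> borel_measurable borel"
  unfolding neg_part_def[abs_def] pos_part_def[abs_def] by measurable

text \<open>The level L exceeds the rescaled tail of the negative part; the assumption \<open>tail_neg\<close> says
  so in terms of (p - 1)-th powers.\<close>

locale DG_minus_on_balls =
  fixes s p \<gamma> :: real and E :: "'a::euclidean_space set" and u :: "'a \<Rightarrow> real"
    and x0 :: 'a and R \<rho> L :: real
  assumes p: "1 < p" and s: "0 < s" "s < 1" and \<gamma>: "0 < \<gamma>"
    and DG: "u \<in> DG_minus s p E \<gamma>"
    and ball_E: "ball x0 R \<subseteq> E"
    and u_nonneg: "AE x in lebesgue. x \<in> ball x0 R \<longrightarrow> 0 \<le> u x"
    and \<rho>: "0 < \<rho>" "\<rho> \<le> R" and L: "0 < L"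
    and tail_neg: "ennreal (\<rho> powr (s * p)) *
      (\<integral>\<^sup>+x\<in>- ball x0 R. ennreal (neg_part (u x) powr (p - 1) / norm (x - x0) powr (DIM('a) + s * p)) \<partial>lebesgue)
      \<le> ennreal (L powr (p - 1))"
begin

lemma u_measurable [measurable]: "u \<in> borel_measurable lebesgue"
  using DG by (simp add: DG_minus_def)

lemma energy_inequality:
  assumes "0 < r" "r < r'" "ball x0 r' \<subseteq> E"
  shows "gagliardo_energy s p (ball x0 r) (\<lambda>x. neg_part (u x - k)) +
      (\<integral>\<^sup>+x\<in>ball x0 r. (\<integral>\<^sup>+y. ennreal (neg_part (u x - k) * pos_part (u y - k) powr (p - 1)
            / norm (x - y) powr (DIM('a) + s * p)) \<partial>lebesgue) \<partial>lebesgue)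
    \<le> ennreal (\<gamma> * r' powr ((1 - s) * p) / (r' - r) powr p) *
        (\<integral>\<^sup>+x\<in>ball x0 r'. ennreal (neg_part (u x - k) powr p) \<partial>lebesgue)
      + ennreal (\<gamma> * r' ^ DIM('a) / (r' - r) powr (DIM('a) + s * p)) *
        (\<integral>\<^sup>+x\<in>ball x0 r'. ennreal (neg_part (u x - k)) \<partial>lebesgue) *
        ennpowr (Tail s p (\<lambda>x. neg_part (u x - k)) x0 r') (p - 1)"
proof -
  have "0 < r \<and> r < r' \<and> ball x0 r' \<subseteq> E" using assms by blast
  from DG[unfolded DG_minus_def Let_def mem_Collect_eq, THEN conjunct2, THEN conjunct2, THEN conjunct2,
      rule_format, OF this, of k]
  show ?thesis .
qed

lemma sp_pos: "0 < s * p"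
  using s p by simp

definition sublevel :: "real \<Rightarrow> real \<Rightarrow> 'a set" where
  "sublevel k r = {x \<in> ball x0 r. u x < k}"

lemma sublevel_measurable [measurable]: "sublevel k r \<in> sets lebesgue"
proof -
  have "{x \<in> space lebesgue. u x < k} \<in> sets lebesgue" by measurable
  then have "ball x0 r \<inter> {x. u x < k} \<in> sets lebesgue" by (intro sets.Int) auto
  moreover have "ball x0 r \<inter> {x. u x < k} = sublevel k r" by (auto simp: sublevel_def)
  ultimately show ?thesis by simp
qed

lemma emeasure_sublevel_le: "emeasure lebesgue (sublevel k r) \<le> emeasure lebesgue (ball x0 r)"
  by (intro emeasure_mono) (auto simp: sublevel_def)

lemma emeasure_sublevel: "emeasure lebesgue (sublevel k r) = ennreal (measure lebesgue (sublevel k r))"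
proof -
  have "emeasure lebesgue (sublevel k r) < \<infinity>"
    using emeasure_sublevel_le[of k r] emeasure_lborel_ball_finite[of x0 r] by (simp add: le_less_trans)
  then show ?thesis by (intro emeasure_eq_ennreal_measure) auto
qed

lemma sublevel_mono: "k \<le> k' \<Longrightarrow> r \<le> r' \<Longrightarrow> sublevel k r \<subseteq> sublevel k' r'"
  by (auto simp: sublevel_def)

lemma measure_sublevel_mono:
  assumes "k \<le> k'" "r \<le> r'"
  shows "measure lebesgue (sublevel k r) \<le> measure lebesgue (sublevel k' r')"
proof -
  have "ennreal (measure lebesgue (sublevel k r)) \<le> ennreal (measure lebesgue (sublevel k' r'))"
    unfolding emeasure_sublevel[symmetric] by (intro emeasure_mono sublevel_mono assms) simp
  then show ?thesis by simp
qed

lemma measure_sublevel_le: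
  assumes "r \<ge> 0"
  shows "measure lebesgue (sublevel k r) \<le> unit_ball_vol DIM('a) * r ^ DIM('a)"
  using emeasure_sublevel_le[of k r] assms unfolding emeasure_sublevel
  by (subst (asm) emeasure_lebesgue_ball) auto

text \<open>The truncation is at most L + u_-. The constant L contributes an integral of the kernel, and
  u_- contributes only outside the ball of radius R, where its tail is controlled by L.\<close>

lemma tail_truncation_le:
  assumes k: "k \<le> L" and r: "0 < r" "r \<le> \<rho>"
  shows "ennreal (r powr (s * p)) *
      (\<integral>\<^sup>+x\<in>- ball x0 r. ennreal (\<bar>neg_part (u x - k)\<bar> powr (p - 1) / norm (x - x0) powr (DIM('a) + s * p)) \<partial>lebesgue)
      \<le> ennreal (2 powr (p - 1) * (1 + kernel_const DIM('a) (s * p)) * L powr (p - 1))"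
proof -
  define q where "q = real DIM('a) + s * p"
  let ?c = "kernel_const DIM('a) (s * p)" and ?b = "2 powr (p - 1)" and ?L = "L powr (p - 1)"
  define I1 where "I1 = (\<integral>\<^sup>+x\<in>- ball x0 r. ennreal (1 / norm (x - x0) powr q) \<partial>lebesgue)"
  define I2 where "I2 = (\<integral>\<^sup>+x\<in>- ball x0 R. ennreal (neg_part (u x) powr (p - 1) / norm (x - x0) powr q) \<partial>lebesgue)"
  have c: "?c > 0" using sp_pos by (rule kernel_const_pos)
  have pointwise: "AE x in lebesgue.
      ennreal (\<bar>neg_part (u x - k)\<bar> powr (p - 1) / norm (x - x0) powr q) * indicator (- ball x0 r) x
      \<le> ennreal (?b * ?L) * (ennreal (1 / norm (x - x0) powr q) * indicator (- ball x0 r) x)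
        + ennreal ?b * (ennreal (neg_part (u x) powr (p - 1) / norm (x - x0) powr q) * indicator (- ball x0 R) x)"
    using u_nonneg
  proof eventually_elim
    case (elim x)
    let ?n = "norm (x - x0) powr q" and ?v = "neg_part (u x) powr (p - 1)"
    have "\<bar>neg_part (u x - k)\<bar> \<le> L + neg_part (u x)"
      using k L by (auto simp: neg_part_def)
    then have "\<bar>neg_part (u x - k)\<bar> powr (p - 1) \<le> (L + neg_part (u x)) powr (p - 1)"
      using p by (intro powr_mono2) auto
    also have "\<dots> \<le> ?b * (?L + ?v)"
      using L p by (intro powr_add_le) auto
    finally have "\<bar>neg_part (u x - k)\<bar> powr (p - 1) / ?n \<le> ?b * (?L + ?v) / ?n"
      by (intro divide_right_mono) auto
    also have "\<dots> = ?b * ?L * (1 / ?n) + ?b * (?v / ?n)"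
      by (simp add: add_divide_distrib ring_distribs)
    finally have le: "ennreal (\<bar>neg_part (u x - k)\<bar> powr (p - 1) / ?n)
        \<le> ennreal (?b * ?L) * ennreal (1 / ?n) + ennreal ?b * ennreal (?v / ?n)"
      by (simp add: ennreal_mult[symmetric] ennreal_plus[symmetric] del: ennreal_plus)
    have v: "?v = 0" if "x \<in> ball x0 R"
      using elim that by (simp add: neg_part_def)
    show ?case
    proof (cases "x \<in> ball x0 r")
      case False
      show ?thesis
      proof (cases "x \<in> ball x0 R")
        case True
        with False le v show ?thesis by simp
      next
        case outside: False
        with False le show ?thesis by simp
      qed
    qed simp
  qed
  have m1: "(\<lambda>x. ennreal (1 / norm (x - x0) powr q) * indicator (- ball x0 r) x) \<in> borel_measurable lebesgue"
    by measurable
  have m2: "(\<lambda>x. ennreal (neg_part (u x) powr (p - 1) / norm (x - x0) powr q) * indicator (- ball x0 R) x)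
      \<in> borel_measurable lebesgue"
    by measurable
  have "(\<integral>\<^sup>+x\<in>- ball x0 r. ennreal (\<bar>neg_part (u x - k)\<bar> powr (p - 1) / norm (x - x0) powr q) \<partial>lebesgue)
      \<le> (\<integral>\<^sup>+x. ennreal (?b * ?L) * (ennreal (1 / norm (x - x0) powr q) * indicator (- ball x0 r) x)
        + ennreal ?b * (ennreal (neg_part (u x) powr (p - 1) / norm (x - x0) powr q) * indicator (- ball x0 R) x) \<partial>lebesgue)"
    by (rule nn_integral_mono_AE[OF pointwise])
  also have "\<dots> = ennreal (?b * ?L) * I1 + ennreal ?b * I2"
    unfolding I1_def I2_def
    using m1 m2 by (subst nn_integral_add; simp only: nn_integral_cmult borel_measurable_times_ennreal borel_measurable_const)
  finally have "ennreal (r powr (s * p)) *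
      (\<integral>\<^sup>+x\<in>- ball x0 r. ennreal (\<bar>neg_part (u x - k)\<bar> powr (p - 1) / norm (x - x0) powr q) \<partial>lebesgue)
      \<le> ennreal (r powr (s * p)) * (ennreal (?b * ?L) * I1 + ennreal ?b * I2)"
    by (intro mult_left_mono) auto
  also have "\<dots> = ennreal (?b * ?L) * (ennreal (r powr (s * p)) * I1) + ennreal ?b * (ennreal (r powr (s * p)) * I2)"
    by (simp add: ring_distribs mult_ac)
  also have "\<dots> \<le> ennreal (?b * ?L) * ennreal ?c + ennreal ?b * ennreal ?L"
  proof (intro add_mono mult_left_mono)
    have "ennreal (r powr (s * p)) * I1 \<le> ennreal (r powr (s * p)) * ennreal (?c * r powr - (s * p))"
      unfolding I1_def q_def using r sp_pos by (intro mult_left_mono kernel_integral_outside_ball) auto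
    also have "\<dots> = ennreal ?c"
      using r c by (simp add: ennreal_mult[symmetric] powr_minus field_simps)
    finally show "ennreal (r powr (s * p)) * I1 \<le> ennreal ?c" .
    have "ennreal (r powr (s * p)) * I2 \<le> ennreal (\<rho> powr (s * p)) * I2"
      using r sp_pos by (intro mult_right_mono ennreal_leI powr_mono2) auto
    also have "\<dots> \<le> ennreal ?L" using tail_neg by (simp add: I2_def q_def)
    finally show "ennreal (r powr (s * p)) * I2 \<le> ennreal ?L" .
  qed auto
  also have "\<dots> = ennreal (?b * (1 + ?c) * ?L)"
    using c by (simp add: ennreal_mult[symmetric] ennreal_plus[symmetric] ring_distribs mult_ac del: ennreal_plus)
  finally show ?thesis by (simp add: q_def)
qed

text \<open>In K_r' the truncation vanishes off the sublevel set and is at most L on it, so each integral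
  on the right of the energy inequality is at most a power of L times the measure of that set. The
  two terms carry the powers p and N + sp of \<rho>/(r' - r); both are absorbed into the
  power N + p because this ratio is at least 1 and s < 1.\<close>

lemma mixed_energy_le:
  assumes k: "k \<le> L" and r: "\<rho> / 2 \<le> r" "r < r'" "r' \<le> \<rho>"
  shows "(\<integral>\<^sup>+x\<in>ball x0 r. (\<integral>\<^sup>+y. ennreal (neg_part (u x - k) * pos_part (u y - k) powr (p - 1)
            / norm (x - y) powr (DIM('a) + s * p)) \<partial>lebesgue) \<partial>lebesgue)
    \<le> ennreal (energy_const DIM('a) s p \<gamma> * \<rho> powr - (s * p) * (\<rho> / (r' - r)) powr (DIM('a) + p)
         * L powr p * measure lebesgue (sublevel k r'))"
    (is "?lhs \<le> _")
proof -
  define q where "q = real DIM('a) + s * p"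
  define d where "d = r' - r"
  define a where "a = measure lebesgue (sublevel k r')"
  define B where "B = 2 powr (p - 1) * (1 + kernel_const DIM('a) (s * p))"
  let ?w = "\<lambda>x. neg_part (u x - k)"
  have r': "0 < r'" "0 < d" "d \<le> \<rho>" "0 \<le> a" using r \<rho> by (auto simp: d_def a_def)
  have B: "B > 0" unfolding B_def using kernel_const_pos[OF sp_pos, of "DIM('a)"]
    by (intro mult_pos_pos add_pos_pos) auto
  have "ball x0 r' \<subseteq> E" using ball_E r \<rho> by (auto simp: subset_iff)
  then have "?lhs \<le> ennreal (\<gamma> * r' powr ((1 - s) * p) / d powr p) * (\<integral>\<^sup>+x\<in>ball x0 r'. ennreal (?w x powr p) \<partial>lebesgue)
      + ennreal (\<gamma> * r' ^ DIM('a) / d powr q) * (\<integral>\<^sup>+x\<in>ball x0 r'. ennreal (?w x) \<partial>lebesgue)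
        * ennpowr (Tail s p ?w x0 r') (p - 1)" (is "_ \<le> ?c1 * ?T1 + ?c2 * ?T2 * ?T3")
    unfolding d_def q_def using r \<rho>
    by (intro order_trans[OF add_increasing[OF zero_le order_refl] energy_inequality]) linarith+
  also have "\<dots> \<le> ?c1 * ennreal (L powr p * a) + ?c2 * ennreal (L * a) * ennreal (B * L powr (p - 1))"
  proof (intro add_mono mult_mono)
    have w: "AE x in lebesgue. x \<in> ball x0 r' \<longrightarrow> ?w x \<le> L * indicator (sublevel k r') x"
      using u_nonneg
    proof eventually_elim
      case (elim x)
      show ?case
      proof
        assume x: "x \<in> ball x0 r'"
        then have "0 \<le> u x" using elim r \<rho> by auto
        then show "?w x \<le> L * indicator (sublevel k r') x"
          using k x by (auto simp: neg_part_def sublevel_def indicator_def)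
      qed
    qed
    have "?T1 \<le> (\<integral>\<^sup>+x. ennreal (L powr p) * indicator (sublevel k r') x \<partial>lebesgue)"
    proof (rule nn_integral_mono_AE, use w in eventually_elim)
      case (elim x)
      have "?w x powr p \<le> (L * indicator (sublevel k r') x) powr p" if "x \<in> ball x0 r'"
        using elim that p by (intro powr_mono2) auto
      then show ?case by (auto simp: indicator_def ennreal_leI)
    qed
    also have "\<dots> = ennreal (L powr p * a)"
      by (simp add: nn_integral_cmult_indicator emeasure_sublevel ennreal_mult a_def)
    finally show "?T1 \<le> ennreal (L powr p * a)" .
    have "?T2 \<le> (\<integral>\<^sup>+x. ennreal L * indicator (sublevel k r') x \<partial>lebesgue)"
      by (rule nn_integral_mono_AE, use w in eventually_elim)
        (auto simp: indicator_def ennreal_leI order.antisym split: if_splits)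
    also have "\<dots> = ennreal (L * a)"
      using L by (simp add: nn_integral_cmult_indicator emeasure_sublevel ennreal_mult a_def)
    finally show "?T2 \<le> ennreal (L * a)" .
    show "?T3 \<le> ennreal (B * L powr (p - 1))"
      using tail_truncation_le[OF k, of r'] p r r'
      by (simp add: Tail_def ennpowr_inverse B_def)
  qed auto
  also have "\<dots> = ennreal (\<gamma> * r' powr ((1 - s) * p) / d powr p * (L powr p * a)
      + \<gamma> * r' ^ DIM('a) / d powr q * (L * a) * (B * L powr (p - 1)))"
    using \<gamma> r' L B by (simp add: ennreal_mult[symmetric] ennreal_plus[symmetric] del: ennreal_plus)
  also have "\<dots> \<le> ennreal (energy_const DIM('a) s p \<gamma> * \<rho> powr - (s * p) * (\<rho> / d) powr (DIM('a) + p) * L powr p * a)"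
  proof (rule ennreal_leI)
    let ?D = "(\<rho> / d) powr (DIM('a) + p)"
    have D1: "r' powr ((1 - s) * p) / d powr p \<le> r' powr - (s * p) * ?D"
    proof -
      have "(1 - s) * p = - (s * p) + p" by (simp add: algebra_simps)
      then have "r' powr ((1 - s) * p) / d powr p = r' powr - (s * p) * (r' / d) powr p"
        using r' by (simp only: powr_add) (simp add: powr_divide)
      also have "(r' / d) powr p \<le> (\<rho> / d) powr p"
        using r r' p by (intro powr_mono2 divide_right_mono) auto
      also have "\<dots> \<le> ?D" using r' by (intro powr_mono) (auto simp: le_divide_eq)
      finally show ?thesis by (simp add: mult_left_mono)
    qed
    have D2: "r' ^ DIM('a) / d powr q \<le> r' powr - (s * p) * ?D"
    proof -
      have "r' ^ DIM('a) / d powr q = r' powr - (s * p) * (r' / d) powr q"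
        using r' by (simp add: powr_divide q_def powr_add powr_minus powr_realpow)
      also have "(r' / d) powr q \<le> (\<rho> / d) powr q"
        using r r' sp_pos by (intro powr_mono2 divide_right_mono) (auto simp: q_def)
      also have "\<dots> \<le> ?D" using r' s p by (intro powr_mono) (auto simp: le_divide_eq q_def)
      finally show ?thesis by (simp add: mult_left_mono)
    qed
    have r'\<rho>: "r' powr - (s * p) \<le> 2 powr (s * p) * \<rho> powr - (s * p)"
    proof -
      have "r' powr - (s * p) \<le> (\<rho> / 2) powr - (s * p)"
        using r \<rho> sp_pos by (intro powr_mono2') auto
      also have "\<dots> = 2 powr (s * p) * \<rho> powr - (s * p)"
        using \<rho> by (simp add: powr_divide powr_minus field_simps)
      finally show ?thesis .
    qed
    have LL: "L * L powr (p - 1) = L powr p" using L by (simp add: powr_diff)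
    have "\<gamma> * r' powr ((1 - s) * p) / d powr p * (L powr p * a)
      + \<gamma> * r' ^ DIM('a) / d powr q * (L * a) * (B * L powr (p - 1))
      = \<gamma> * L powr p * a * (r' powr ((1 - s) * p) / d powr p + B * (r' ^ DIM('a) / d powr q))"
      by (simp add: LL[symmetric] ring_distribs mult_ac)
    also have "\<dots> \<le> \<gamma> * L powr p * a * (r' powr - (s * p) * ?D + B * (r' powr - (s * p) * ?D))"
      using \<gamma> r' B D1 D2 by (intro mult_left_mono add_mono) auto
    also have "\<dots> = \<gamma> * L powr p * a * (1 + B) * ?D * r' powr - (s * p)"
      by (simp add: algebra_simps)
    also have "\<dots> \<le> \<gamma> * L powr p * a * (1 + B) * ?D * (2 powr (s * p) * \<rho> powr - (s * p))"
      using \<gamma> r' B r'\<rho> by (intro mult_left_mono) auto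
    also have "\<dots> = energy_const DIM('a) s p \<gamma> * \<rho> powr - (s * p) * ?D * L powr p * a"
      by (simp add: energy_const_def B_def mult_ac)
    finally show "\<gamma> * r' powr ((1 - s) * p) / d powr p * (L powr p * a)
      + \<gamma> * r' ^ DIM('a) / d powr q * (L * a) * (B * L powr (p - 1))
      \<le> energy_const DIM('a) s p \<gamma> * \<rho> powr - (s * p) * ?D * L powr p * a" .
  qed
  finally show ?thesis by (simp add: a_def d_def)
qed

section \<open>Two lower bounds for the mixed term\<close>

text \<open>For x in the smaller ball and y outside K_\<rho> one has |x - y| \<le> 2 |y - x0|. Hence at every
  point with u < L/2, where the truncation at level L is at least L/2, the inner integral
  dominates a multiple of the tail of (u - L)_+. This bounds the measure of the set of such points
  by the energy divided by that tail.\<close>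

lemma sublevel_small_of_large_tail:
  assumes M: "0 \<le> M"
    and tail: "ennreal (M * L powr (p - 1)) \<le> ennreal (\<rho> powr (s * p)) *
      (\<integral>\<^sup>+y\<in>- ball x0 \<rho>. ennreal (pos_part (u y - L) powr (p - 1) / norm (y - x0) powr (DIM('a) + s * p)) \<partial>lebesgue)"
  shows "M * measure lebesgue (sublevel (L / 2) (3 / 4 * \<rho>))
    \<le> 2 * 2 powr (DIM('a) + s * p) * 4 powr (DIM('a) + p) * energy_const DIM('a) s p \<gamma>
        * (unit_ball_vol DIM('a) * \<rho> ^ DIM('a))"
proof -
  define q where "q = real DIM('a) + s * p"
  define m where "m = real DIM('a) + p"
  define C where "C = energy_const DIM('a) s p \<gamma>"
  define V where "V = unit_ball_vol DIM('a) * \<rho> ^ DIM('a)"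
  define A where "A = sublevel (L / 2) (3 / 4 * \<rho>)"
  define h where "h = L / 2 * 2 powr - q"
  define g where "g y = ennreal (pos_part (u y - L) powr (p - 1) / norm (y - x0) powr q) * indicator (- ball x0 \<rho>) y" for y
  define J where "J = integral\<^sup>N lebesgue g"
  define outer where "outer = (\<integral>\<^sup>+x\<in>ball x0 (3 / 4 * \<rho>).
    (\<integral>\<^sup>+y. ennreal (neg_part (u x - L) * pos_part (u y - L) powr (p - 1) / norm (x - y) powr q) \<partial>lebesgue) \<partial>lebesgue)"
  have q: "0 < q" using sp_pos by (simp add: q_def add_nonneg_pos)
  have C: "0 < C" unfolding C_def using s p \<gamma> by (intro energy_const_pos) auto
  have g[measurable]: "g \<in> borel_measurable lebesgue" unfolding g_def by measurable
  have h: "0 \<le> h" using L by (simp add: h_def)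
  have "ennreal h * J * indicator A x \<le>
      (\<integral>\<^sup>+y. ennreal (neg_part (u x - L) * pos_part (u y - L) powr (p - 1) / norm (x - y) powr q) \<partial>lebesgue)
      * indicator (ball x0 (3 / 4 * \<rho>)) x" for x
  proof (cases "x \<in> A")
    case True
    then have x: "dist x0 x < 3 / 4 * \<rho>" "u x < L / 2" by (auto simp: A_def sublevel_def)
    have w: "L / 2 \<le> neg_part (u x - L)" using x by (simp add: neg_part_def le_max_iff_disj)
    have "ennreal h * g y \<le> ennreal (neg_part (u x - L) * pos_part (u y - L) powr (p - 1) / norm (x - y) powr q)" for y
    proof (cases "y \<in> ball x0 \<rho>")
      case False
      then have y: "\<rho> \<le> norm (y - x0)" by (simp add: dist_norm norm_minus_commute)
      have xy: "norm (x - y) \<le> 2 * norm (y - x0)" "0 < norm (x - y)"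
        using x y \<rho> False norm_triangle_ineq4[of "x - x0" "y - x0"]
        by (auto simp: dist_norm norm_minus_commute)
      have "norm (x - y) powr q \<le> 2 powr q * norm (y - x0) powr q"
        using xy q by (subst powr_mult[symmetric]) (auto intro!: powr_mono2)
      then have "1 / (2 powr q * norm (y - x0) powr q) \<le> 1 / norm (x - y) powr q"
        using xy y \<rho> by (intro divide_left_mono mult_pos_pos) auto
      then have "L / 2 * pos_part (u y - L) powr (p - 1) * (1 / (2 powr q * norm (y - x0) powr q))
          \<le> neg_part (u x - L) * pos_part (u y - L) powr (p - 1) * (1 / norm (x - y) powr q)"
        using w L by (intro mult_mono) auto
      moreover have "L / 2 * pos_part (u y - L) powr (p - 1) * (1 / (2 powr q * norm (y - x0) powr q))
          = h * (pos_part (u y - L) powr (p - 1) / norm (y - x0) powr q)"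
        by (simp add: h_def powr_minus field_simps)
      ultimately show ?thesis using False h
        by (simp add: g_def ennreal_mult[symmetric] ennreal_leI)
    qed (simp add: g_def)
    then have "(\<integral>\<^sup>+y. ennreal h * g y \<partial>lebesgue) \<le>
      (\<integral>\<^sup>+y. ennreal (neg_part (u x - L) * pos_part (u y - L) powr (p - 1) / norm (x - y) powr q) \<partial>lebesgue)"
      by (intro nn_integral_mono)
    then show ?thesis using True x by (simp add: nn_integral_cmult J_def)
  qed simp
  then have "(\<integral>\<^sup>+x. ennreal h * J * indicator A x \<partial>lebesgue) \<le> outer"
    unfolding outer_def by (intro nn_integral_mono)
  also have "(\<integral>\<^sup>+x. ennreal h * J * indicator A x \<partial>lebesgue) = ennreal h * J * emeasure lebesgue A"
    by (rule nn_integral_cmult_indicator) (simp add: A_def)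
  finally have "ennreal h * J * ennreal (measure lebesgue A) \<le> outer"
    by (simp add: A_def emeasure_sublevel)
  also have "outer \<le> ennreal (C * \<rho> powr - (s * p) * (\<rho> / (\<rho> - 3 / 4 * \<rho>)) powr m * L powr p * measure lebesgue (sublevel L \<rho>))"
    unfolding outer_def q_def C_def m_def using \<rho> by (intro mixed_energy_le) auto
  also have "\<dots> \<le> ennreal (C * \<rho> powr - (s * p) * 4 powr m * L powr p * V)"
  proof (intro ennreal_leI)
    have "\<rho> / (\<rho> - 3 / 4 * \<rho>) = 4" using \<rho> by (simp add: field_simps)
    then show "C * \<rho> powr - (s * p) * (\<rho> / (\<rho> - 3 / 4 * \<rho>)) powr m * L powr p * measure lebesgue (sublevel L \<rho>)
        \<le> C * \<rho> powr - (s * p) * 4 powr m * L powr p * V"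
      using measure_sublevel_le[of \<rho> L] \<rho> C by (simp add: V_def mult_left_mono)
  qed
  finally have "ennreal (\<rho> powr (s * p)) * (ennreal h * J * ennreal (measure lebesgue A))
      \<le> ennreal (\<rho> powr (s * p)) * ennreal (C * \<rho> powr - (s * p) * 4 powr m * L powr p * V)"
    by (rule mult_left_mono) simp
  also have "\<dots> = ennreal (C * 4 powr m * L powr p * V)"
    using \<rho> by (subst ennreal_mult'[symmetric]) (auto simp: powr_minus field_simps)
  finally have upper: "ennreal h * ennreal (measure lebesgue A) * (ennreal (\<rho> powr (s * p)) * J)
      \<le> ennreal (C * 4 powr m * L powr p * V)"
    by (simp add: mult_ac)
  have "ennreal (h * measure lebesgue A * (M * L powr (p - 1)))
      = ennreal h * ennreal (measure lebesgue A) * ennreal (M * L powr (p - 1))"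
    using h M by (simp add: ennreal_mult)
  also have "\<dots> \<le> ennreal h * ennreal (measure lebesgue A) * (ennreal (\<rho> powr (s * p)) * J)"
    using tail by (intro mult_left_mono) (simp_all add: J_def g_def[abs_def] q_def)
  also note upper
  finally have "h * measure lebesgue A * (M * L powr (p - 1)) \<le> C * 4 powr m * L powr p * V"
    using C \<rho> by (subst (asm) ennreal_le_iff) (auto simp: V_def)
  moreover have "L powr p = L * L powr (p - 1)" using L by (simp add: powr_diff)
  ultimately have "L powr p * (M * measure lebesgue A) \<le> L powr p * (2 * 2 powr q * 4 powr m * C * V)"
    using L by (simp add: h_def powr_minus field_simps)
  then show ?thesis using L by (simp add: A_def q_def m_def C_def V_def)
qed

text \<open>This takes the place of a Sobolev inequality. The energy inequality is used at the level l
  halfway between k' and k, so that w_- is at least (k - k')/2 where u < k', and w_+ is at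
  least (k - k')/2 where u \<ge> k. By the smallness hypothesis at least half of every ball of radius t
  centred in K_r belongs to the second set, and there the kernel exceeds t^(-N-sp).\<close>

lemma sublevel_step:
  assumes k: "0 < k'" "k' < k" "k \<le> L" and r: "\<rho> / 2 \<le> r" "r < r'" "r' \<le> \<rho>"
    and t: "0 < t" "t \<le> r' - r"
    and small: "measure lebesgue (sublevel k r') \<le> unit_ball_vol DIM('a) / 2 * t ^ DIM('a)"
  shows "((k - k') / 2) powr p * (unit_ball_vol DIM('a) / 2) * t powr - (s * p) * measure lebesgue (sublevel k' r)
    \<le> energy_const DIM('a) s p \<gamma> * \<rho> powr - (s * p) * (\<rho> / (r' - r)) powr (DIM('a) + p)
         * L powr p * measure lebesgue (sublevel k r')"
proof -
  define q where "q = real DIM('a) + s * p"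
  define m where "m = real DIM('a) + p"
  define C where "C = energy_const DIM('a) s p \<gamma>"
  define \<omega> where "\<omega> = unit_ball_vol DIM('a)"
  define h where "h = (k - k') / 2"
  define l where "l = (k + k') / 2"
  define c where "c = h * h powr (p - 1) / t powr q"
  define S where "S = sublevel k r'"
  have q: "0 < q" using sp_pos by (simp add: q_def add_nonneg_pos)
  have C: "0 < C" unfolding C_def using s p \<gamma> by (intro energy_const_pos) auto
  have h: "0 < h" using k by (simp add: h_def)
  have c: "0 \<le> c" using h by (simp add: c_def)
  have "ennreal (c * (\<omega> / 2 * t ^ DIM('a))) * indicator (sublevel k' r) x \<le>
      (\<integral>\<^sup>+y. ennreal (neg_part (u x - l) * pos_part (u y - l) powr (p - 1) / norm (x - y) powr q) \<partial>lebesgue)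
      * indicator (ball x0 r) x" for x
  proof (cases "x \<in> sublevel k' r")
    case True
    then have x: "dist x0 x < r" "u x < k'" by (auto simp: sublevel_def)
    have w: "h \<le> neg_part (u x - l)" using x by (simp add: neg_part_def h_def l_def le_max_iff_disj) (simp add: field_simps)
    have "ennreal c * indicator (ball x t - S) y
        \<le> ennreal (neg_part (u x - l) * pos_part (u y - l) powr (p - 1) / norm (x - y) powr q)" for y
    proof (cases "y \<in> ball x t - S")
      case y: True
      then have xy: "norm (x - y) < t" by (simp add: dist_norm)
      have "dist x0 y \<le> dist x0 x + dist x y" by (rule dist_triangle)
      then have "y \<in> ball x0 r'" using x xy t by (simp add: dist_norm)
      then have "k \<le> u y" using y by (auto simp: S_def sublevel_def)
      then have wy: "h \<le> pos_part (u y - l)" by (simp add: pos_part_def h_def l_def le_max_iff_disj) (simp add: field_simps)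
      (* the kernel has the value 0 on the diagonal, so the point x itself must be excluded *)
      have "x \<noteq> y" using \<open>k \<le> u y\<close> x k by auto
      have "c \<le> neg_part (u x - l) * pos_part (u y - l) powr (p - 1) / norm (x - y) powr q"
        unfolding c_def using w wy h p q xy \<open>x \<noteq> y\<close>
        by (intro frac_le mult_mono powr_mono2) auto
      then show ?thesis using y by (simp add: ennreal_leI)
    qed simp
    then have "(\<integral>\<^sup>+y. ennreal c * indicator (ball x t - S) y \<partial>lebesgue) \<le>
      (\<integral>\<^sup>+y. ennreal (neg_part (u x - l) * pos_part (u y - l) powr (p - 1) / norm (x - y) powr q) \<partial>lebesgue)"
      by (intro nn_integral_mono)
    moreover have "(\<integral>\<^sup>+y. ennreal c * indicator (ball x t - S) y \<partial>lebesgue)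
        = ennreal c * emeasure lebesgue (ball x t - S)"
      by (rule nn_integral_cmult_indicator) (simp add: S_def)
    moreover have "ennreal (\<omega> / 2 * t ^ DIM('a)) \<le> emeasure lebesgue (ball x t - S)"
    proof -
      have "ennreal (\<omega> * t ^ DIM('a)) = emeasure lebesgue (ball x t)"
        using t by (simp only: emeasure_lebesgue_ball[OF less_imp_le] \<omega>_def)
      also have "\<dots> \<le> emeasure lebesgue ((ball x t - S) \<union> S)"
        by (intro emeasure_mono) (auto simp: S_def)
      also have "\<dots> \<le> emeasure lebesgue (ball x t - S) + emeasure lebesgue S"
        by (intro emeasure_subadditive) (auto simp: S_def)
      also have "emeasure lebesgue S \<le> ennreal (\<omega> / 2 * t ^ DIM('a))"
        using small by (simp add: S_def emeasure_sublevel \<omega>_def ennreal_leI)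
      finally have "ennreal (\<omega> * t ^ DIM('a)) - ennreal (\<omega> / 2 * t ^ DIM('a)) \<le> emeasure lebesgue (ball x t - S)"
        by (subst ennreal_minus_le_iff) (auto simp: add.commute add_mono)
      moreover have "ennreal (\<omega> * t ^ DIM('a)) - ennreal (\<omega> / 2 * t ^ DIM('a)) = ennreal (\<omega> / 2 * t ^ DIM('a))"
        using t by (subst ennreal_minus) (auto simp: \<omega>_def field_simps)
      ultimately show ?thesis by simp
    qed
    then have "ennreal (c * (\<omega> / 2 * t ^ DIM('a))) \<le> ennreal c * emeasure lebesgue (ball x t - S)"
      using c t by (subst ennreal_mult) (auto intro!: mult_left_mono simp: \<omega>_def)
    ultimately show ?thesis using True x by simp
  qed simp
  then have "(\<integral>\<^sup>+x. ennreal (c * (\<omega> / 2 * t ^ DIM('a))) * indicator (sublevel k' r) x \<partial>lebesgue) \<le>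
      (\<integral>\<^sup>+x\<in>ball x0 r. (\<integral>\<^sup>+y. ennreal (neg_part (u x - l) * pos_part (u y - l) powr (p - 1) / norm (x - y) powr q) \<partial>lebesgue) \<partial>lebesgue)"
    by (intro nn_integral_mono)
  also have "\<dots> \<le> ennreal (C * \<rho> powr - (s * p) * (\<rho> / (r' - r)) powr m * L powr p * measure lebesgue (sublevel l r'))"
    unfolding q_def m_def C_def using k r by (intro mixed_energy_le) (auto simp: l_def)
  also have "\<dots> \<le> ennreal (C * \<rho> powr - (s * p) * (\<rho> / (r' - r)) powr m * L powr p * measure lebesgue S)"
    unfolding S_def using C k by (intro ennreal_leI mult_left_mono measure_sublevel_mono) (auto simp: l_def)
  also have "(\<integral>\<^sup>+x. ennreal (c * (\<omega> / 2 * t ^ DIM('a))) * indicator (sublevel k' r) x \<partial>lebesgue)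
      = ennreal (c * (\<omega> / 2 * t ^ DIM('a)) * measure lebesgue (sublevel k' r))"
    by (subst nn_integral_cmult_indicator, simp, subst ennreal_mult'', simp, simp only: emeasure_sublevel)
  finally have "c * (\<omega> / 2 * t ^ DIM('a)) * measure lebesgue (sublevel k' r)
      \<le> C * \<rho> powr - (s * p) * (\<rho> / (r' - r)) powr m * L powr p * measure lebesgue S"
    using C by (subst (asm) ennreal_le_iff) auto
  moreover have "c * (\<omega> / 2 * t ^ DIM('a)) = h powr p * (\<omega> / 2) * t powr - (s * p)"
    using h t by (simp add: c_def q_def powr_add powr_realpow powr_diff powr_minus field_simps)
  ultimately show ?thesis by (simp only: h_def C_def m_def S_def \<omega>_def)
qed

end

section \<open>Iteration over shrinking sublevel sets\<close>

text \<open>In the j-th step the distances between consecutive levels and radii are proportional to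
  2^(-j), which costs a factor 2^(j(n + 2p)): the power p for the levels and n + p for the
  radii. With t proportional to the j-th power of this ratio, the gain t^(-sp) balances the loss
  exactly.\<close>

definition decay_ratio :: "nat \<Rightarrow> real \<Rightarrow> real \<Rightarrow> real" where
  "decay_ratio n s p = 2 powr - ((n + 2 * p) / (s * p))"

text \<open>The constant left over in a step once the powers of 2^j have cancelled; 16 and 8 are the
  ratios of L and \<rho> to the half level gap and the radius gap in the step j = 0.\<close>

definition step_const :: "nat \<Rightarrow> real \<Rightarrow> real \<Rightarrow> real \<Rightarrow> real" where
  "step_const n s p \<gamma> = energy_const n s p \<gamma> * (2 / unit_ball_vol n) * 16 powr p * 8 powr (n + p)"

text \<open>The initial t is this multiple of \<rho>. The bound 1/8 keeps t below the gap between the radii,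
  and the other bound makes the measure shrink as fast as t^n.\<close>

definition radius_const :: "nat \<Rightarrow> real \<Rightarrow> real \<Rightarrow> real \<Rightarrow> real" where
  "radius_const n s p \<gamma> = min (1 / 8) ((decay_ratio n s p ^ n / step_const n s p \<gamma>) powr (1 / (s * p)))"

text \<open>The first summand compensates for the passage from the tail of u_+ to that of (u - L)_+; the
  second one makes the sublevel set small enough for the iteration to start.\<close>

definition tail_const :: "nat \<Rightarrow> real \<Rightarrow> real \<Rightarrow> real \<Rightarrow> real" where
  "tail_const n s p \<gamma> = 2 powr (p - 1) * (kernel_const n (s * p)
     + 4 * 2 powr (n + s * p) * 4 powr (n + p) * energy_const n s p \<gamma> / radius_const n s p \<gamma> ^ n)"

lemma decay_ratio_bounds:
  assumes "0 < s" "s < 1" "1 < p"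
  shows "0 < decay_ratio n s p" "decay_ratio n s p \<le> 1 / 2"
proof -
  have "s * p \<le> 1 * p" using assms by (intro mult_right_mono) auto
  then have "s * p \<le> n + 2 * p" using assms by linarith
  then have "1 \<le> (n + 2 * p) / (s * p)" using assms by (simp add: le_divide_eq)
  then have "2 powr - ((n + 2 * p) / (s * p)) \<le> 2 powr (-1 :: real)" by (intro powr_mono) auto
  then show "decay_ratio n s p \<le> 1 / 2" by (simp add: decay_ratio_def powr_minus)
qed (simp add: decay_ratio_def)

lemma step_const_pos:
  assumes "0 < s" "1 < p" "0 < \<gamma>"
  shows "step_const n s p \<gamma> > 0"
  using energy_const_pos[OF assms, of n] by (simp add: step_const_def)

lemma radius_const_pos:
  assumes "0 < s" "s < 1" "1 < p" "0 < \<gamma>"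
  shows "radius_const n s p \<gamma> > 0"
  using decay_ratio_bounds(1)[of s p n] step_const_pos[of s p \<gamma> n] assms by (simp add: radius_const_def)

lemma tail_const_pos:
  assumes "0 < s" "s < 1" "1 < p" "0 < \<gamma>"
  shows "tail_const n s p \<gamma> > 0"
  using radius_const_pos[OF assms, of n] kernel_const_pos[of "s * p" n] energy_const_pos[of s p \<gamma> n] assms
  unfolding tail_const_def by (intro mult_pos_pos add_pos_nonneg) auto

context DG_minus_on_balls
begin

text \<open>The sublevel sets at the levels L/4 (1 + 2^(-j)) and radii \<rho>/2 (1 + 2^(-j-1)) are shown by
  induction to have measure at most half that of a ball of radius t_j. This is precisely the
  hypothesis under which the next step may be taken with t = t_j. As t_j tends to 0, the set where
  u < L/4 in the limiting ball is null.\<close>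

lemma lower_bound_of_small_sublevel:
  assumes small: "measure lebesgue (sublevel (L / 2) (3 / 4 * \<rho>))
    \<le> unit_ball_vol DIM('a) / 2 * (\<rho> * radius_const DIM('a) s p \<gamma>) ^ DIM('a)"
  shows "AE x in lebesgue. x \<in> ball x0 (\<rho> / 2) \<longrightarrow> L / 4 \<le> u x"
proof -
  define m where "m = real DIM('a) + p"
  define C where "C = energy_const DIM('a) s p \<gamma>"
  define D where "D = step_const DIM('a) s p \<gamma>"
  define \<omega> where "\<omega> = unit_ball_vol DIM('a)"
  define \<mu> where "\<mu> = decay_ratio DIM('a) s p"
  define \<tau> where "\<tau> = radius_const DIM('a) s p \<gamma>"
  define k where "k j = L / 4 * (1 + (1 / 2) ^ j)" for j :: nat
  define r where "r j = \<rho> / 2 * (1 + (1 / 2) ^ Suc j)" for j :: nat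
  define t where "t j = \<rho> * \<tau> * \<mu> ^ j" for j :: nat
  define a where "a j = measure lebesgue (sublevel (k j) (r j))" for j
  have \<mu>: "0 < \<mu>" "\<mu> \<le> 1 / 2" using decay_ratio_bounds[of s p "DIM('a)"] s p by (auto simp: \<mu>_def)
  have \<tau>: "0 < \<tau>" "\<tau> \<le> 1 / 8" using radius_const_pos[of s p \<gamma> "DIM('a)"] s p \<gamma>
    by (auto simp: \<tau>_def radius_const_def)
  have \<omega>: "0 < \<omega>" by (simp add: \<omega>_def)
  have C: "0 < C" unfolding C_def using s p \<gamma> by (intro energy_const_pos) auto
  have D: "0 < D" unfolding D_def using s p \<gamma> by (intro step_const_pos) auto
  have t: "0 < t j" for j using \<rho> \<tau> \<mu> by (simp add: t_def)
  have a_nonneg: "0 \<le> a j" for j by (simp add: a_def)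
  have decay: "a j \<le> \<omega> / 2 * t j ^ DIM('a)" for j
  proof (induction j)
    case 0
    have "L / 4 * (1 + (1 / 2) ^ 0) = L / 2" "\<rho> / 2 * (1 + (1 / 2) ^ Suc 0) = 3 / 4 * \<rho>" by auto
    then show ?case using small by (simp only: a_def k_def r_def t_def \<omega>_def \<tau>_def) simp
  next
    case (Suc j)
    define z :: real where "z = (1 / 2) ^ j"
    have z: "0 < z" "z \<le> 1" by (auto simp: z_def power_le_one)
    have dk: "(k j - k (Suc j)) / 2 = L * z / 16" by (simp add: k_def z_def field_simps)
    have dr: "r j - r (Suc j) = \<rho> * z / 8" by (simp add: r_def z_def field_simps)
    have "\<tau> * \<mu> ^ j \<le> 1 / 8 * z" unfolding z_def using \<tau> \<mu> by (intro mult_mono power_mono) auto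
    then have "t j \<le> r j - r (Suc j)" using \<rho> by (simp add: t_def dr)
    moreover have kr: "0 < k (Suc j)" "k (Suc j) < k j" "k j \<le> L" "\<rho> / 2 \<le> r (Suc j)" "r (Suc j) < r j" "r j \<le> \<rho>"
    proof -
      have "k j = L / 4 + L * z / 4" "k (Suc j) = L / 4 + L * z / 8"
        "r j = \<rho> / 2 + \<rho> * z / 4" "r (Suc j) = \<rho> / 2 + \<rho> * z / 8"
        by (simp_all add: k_def r_def z_def algebra_simps)
      moreover have "L * z \<le> L * 1" "\<rho> * z \<le> \<rho> * 1"
        using L \<rho> z by (intro mult_left_mono; simp)+
      moreover have "0 < L * z" "0 < \<rho> * z"
        using L \<rho> z by simp_all
      ultimately show "0 < k (Suc j)" "k (Suc j) < k j" "k j \<le> L" "\<rho> / 2 \<le> r (Suc j)" "r (Suc j) < r j" "r j \<le> \<rho>"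
        using L \<rho> by linarith+
    qed
    ultimately have step: "(L * z / 16) powr p * (\<omega> / 2) * t j powr - (s * p) * a (Suc j)
        \<le> C * \<rho> powr - (s * p) * (\<rho> / (\<rho> * z / 8)) powr m * L powr p * a j"
      unfolding a_def C_def \<omega>_def m_def dk[symmetric] dr[symmetric]
      using Suc t kr unfolding a_def \<omega>_def by (intro sublevel_step) auto
    have "\<mu> powr (s * p) = 2 powr - (m + p)"
      unfolding \<mu>_def decay_ratio_def m_def powr_powr
      by (rule arg_cong[where f = "(powr) 2"]) (use s p in simp)
    moreover have "(\<mu> ^ j) powr (s * p) = (\<mu> powr (s * p)) ^ j"
      using \<mu> by (simp add: powr_power powr_realpow[symmetric] powr_powr mult.commute)
    ultimately have "(\<mu> ^ j) powr (s * p) = (2 powr - (m + p)) ^ j" by simp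
    also have "(2::real) powr - (m + p) = (1 / 2) powr (m + p)"
      by (simp only: powr_minus_divide powr_divide powr_one_eq_one)
    also have "\<dots> ^ j = ((1 / 2) ^ j) powr (m + p)"
      by (simp add: powr_power powr_realpow[symmetric] powr_powr mult.commute)
    also have "\<dots> = z powr (m + p)" by (simp add: z_def)
    finally have \<mu>_sp: "(\<mu> ^ j) powr (s * p) = z powr m * z powr p"
      by (simp add: powr_add)
    have t_sp: "t j powr - (s * p) = \<rho> powr - (s * p) / (\<tau> powr (s * p) * (z powr m * z powr p))"
      using \<rho> \<tau> \<mu> by (simp add: t_def powr_mult powr_minus \<mu>_sp[symmetric] field_simps)
    have z16: "(L * z / 16) powr p = L powr p * z powr p / 16 powr p"
      using L z by (simp add: powr_divide powr_mult)
    have z8: "(\<rho> / (\<rho> * z / 8)) powr m = 8 powr m / z powr m"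
      using \<rho> z by (simp add: powr_divide)
    define X where "X = \<rho> powr - (s * p) * L powr p / z powr m"
    have X: "0 < X" using \<rho> L z by (simp add: X_def)
    have "X * (\<omega> / 2 / 16 powr p / \<tau> powr (s * p) * a (Suc j)) \<le> X * (C * 8 powr m * a j)"
      using step z \<tau> unfolding t_sp z16 z8 X_def by (simp add: field_simps)
    then have "\<omega> / 2 / 16 powr p / \<tau> powr (s * p) * a (Suc j) \<le> C * 8 powr m * a j"
      by (rule mult_left_le_imp_le[OF _ X])
    then have "a (Suc j) \<le> D * \<tau> powr (s * p) * a j"
      using \<omega> \<tau> by (simp add: D_def step_const_def C_def m_def \<omega>_def field_simps)
    also have "\<dots> \<le> \<mu> ^ DIM('a) * a j"
    proof (intro mult_right_mono a_nonneg)
      have "\<tau> powr (s * p) \<le> ((\<mu> ^ DIM('a) / D) powr (1 / (s * p))) powr (s * p)"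
        using \<tau> sp_pos by (intro powr_mono2) (auto simp: \<tau>_def radius_const_def D_def \<mu>_def)
      also have "\<dots> = \<mu> ^ DIM('a) / D"
        using s p \<mu> D by (simp add: powr_powr)
      finally show "D * \<tau> powr (s * p) \<le> \<mu> ^ DIM('a)"
        using D by (simp add: field_simps)
    qed
    also have "\<dots> \<le> \<mu> ^ DIM('a) * (\<omega> / 2 * t j ^ DIM('a))"
      using Suc \<mu> by (intro mult_left_mono) auto
    also have "\<dots> = \<omega> / 2 * t (Suc j) ^ DIM('a)"
      by (simp add: t_def power_mult_distrib)
    finally show ?case .
  qed
  have "t \<longlonglongrightarrow> \<rho> * \<tau> * 0"
    unfolding t_def using \<mu> by (intro tendsto_intros LIMSEQ_power_zero) auto
  then have "(\<lambda>j. \<omega> / 2 * t j ^ DIM('a)) \<longlonglongrightarrow> \<omega> / 2 * 0 ^ DIM('a)"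
    by (intro tendsto_intros) simp
  also have "\<omega> / 2 * 0 ^ DIM('a) = 0" by simp
  finally have "(\<lambda>j. \<omega> / 2 * t j ^ DIM('a)) \<longlonglongrightarrow> 0" .
  moreover have "measure lebesgue (sublevel (L / 4) (\<rho> / 2)) \<le> \<omega> / 2 * t j ^ DIM('a)" for j
  proof -
    have "measure lebesgue (sublevel (L / 4) (\<rho> / 2)) \<le> a j"
      unfolding a_def using L \<rho> by (intro measure_sublevel_mono) (auto simp: k_def r_def)
    also note decay
    finally show ?thesis .
  qed
  ultimately have "measure lebesgue (sublevel (L / 4) (\<rho> / 2)) \<le> 0"
    by (intro LIMSEQ_le_const) blast+
  then have "emeasure lebesgue (sublevel (L / 4) (\<rho> / 2)) = 0"
    by (simp add: emeasure_sublevel order.antisym)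
  then have "AE x in lebesgue. x \<notin> sublevel (L / 4) (\<rho> / 2)"
    by (intro AE_not_in) (simp add: null_setsI)
  then show ?thesis
    by eventually_elim (auto simp: sublevel_def)
qed

text \<open>Since u_+ \<le> L + (u - L)_+ and the constant L has tail of order L, a large tail of u_+ forces a
  large tail of (u - L)_+. All terms subtracted in this argument are finite, so the tail of u_+ may
  be infinite.\<close>

lemma lower_bound_of_large_tail:
  assumes tail: "ennreal (tail_const DIM('a) s p \<gamma> * L powr (p - 1)) \<le> ennreal (\<rho> powr (s * p)) *
      (\<integral>\<^sup>+x\<in>- ball x0 \<rho>. ennreal (pos_part (u x) powr (p - 1) / norm (x - x0) powr (DIM('a) + s * p)) \<partial>lebesgue)"
  shows "AE x in lebesgue. x \<in> ball x0 (\<rho> / 2) \<longrightarrow> L / 4 \<le> u x"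
proof (rule lower_bound_of_small_sublevel)
  define q where "q = real DIM('a) + s * p"
  define b where "b = 2 powr (p - 1)"
  define \<kappa> where "\<kappa> = kernel_const DIM('a) (s * p)"
  define \<tau> where "\<tau> = radius_const DIM('a) s p \<gamma>"
  define C where "C = energy_const DIM('a) s p \<gamma>"
  define M where "M = 4 * 2 powr q * 4 powr (DIM('a) + p) * C / \<tau> ^ DIM('a)"
  define I1 where "I1 = (\<integral>\<^sup>+x\<in>- ball x0 \<rho>. ennreal (1 / norm (x - x0) powr q) \<partial>lebesgue)"
  define J where "J = (\<integral>\<^sup>+x\<in>- ball x0 \<rho>. ennreal (pos_part (u x - L) powr (p - 1) / norm (x - x0) powr q) \<partial>lebesgue)"
  let ?L = "L powr (p - 1)"
  have C: "0 < C" unfolding C_def using s p \<gamma> by (intro energy_const_pos) auto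
  have \<tau>: "0 < \<tau>" unfolding \<tau>_def using s p \<gamma> by (intro radius_const_pos) auto
  have \<kappa>: "0 < \<kappa>" unfolding \<kappa>_def using sp_pos by (rule kernel_const_pos)
  have M: "0 < M" using C \<tau> by (simp add: M_def)
  have b: "0 < b" by (simp add: b_def)
  have m1: "(\<lambda>x. ennreal (1 / norm (x - x0) powr q) * indicator (- ball x0 \<rho>) x) \<in> borel_measurable lebesgue"
    by measurable
  have m2: "(\<lambda>x. ennreal (pos_part (u x - L) powr (p - 1) / norm (x - x0) powr q) * indicator (- ball x0 \<rho>) x)
      \<in> borel_measurable lebesgue"
    by measurable
  have pointwise: "ennreal (pos_part (u x) powr (p - 1) / norm (x - x0) powr q)
      \<le> ennreal (b * ?L) * ennreal (1 / norm (x - x0) powr q)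
        + ennreal b * ennreal (pos_part (u x - L) powr (p - 1) / norm (x - x0) powr q)" for x
  proof -
    let ?n = "norm (x - x0) powr q"
    have "pos_part (u x) powr (p - 1) \<le> (L + pos_part (u x - L)) powr (p - 1)"
      using p L by (intro powr_mono2) (auto simp: pos_part_def)
    also have "\<dots> \<le> b * (?L + pos_part (u x - L) powr (p - 1))"
      unfolding b_def using L p by (intro powr_add_le) auto
    finally have "pos_part (u x) powr (p - 1) / ?n \<le> b * (?L + pos_part (u x - L) powr (p - 1)) / ?n"
      by (intro divide_right_mono) auto
    also have "\<dots> = b * ?L * (1 / ?n) + b * (pos_part (u x - L) powr (p - 1) / ?n)"
      by (simp add: add_divide_distrib ring_distribs)
    finally show ?thesis using b
      by (simp add: ennreal_mult[symmetric] ennreal_plus[symmetric] ennreal_leI del: ennreal_plus)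
  qed
  have "(\<integral>\<^sup>+x\<in>- ball x0 \<rho>. ennreal (pos_part (u x) powr (p - 1) / norm (x - x0) powr q) \<partial>lebesgue)
      \<le> (\<integral>\<^sup>+x. ennreal (b * ?L) * (ennreal (1 / norm (x - x0) powr q) * indicator (- ball x0 \<rho>) x)
        + ennreal b * (ennreal (pos_part (u x - L) powr (p - 1) / norm (x - x0) powr q) * indicator (- ball x0 \<rho>) x) \<partial>lebesgue)"
    using pointwise by (intro nn_integral_mono) (simp add: indicator_def)
  also have "\<dots> = ennreal (b * ?L) * I1 + ennreal b * J"
    unfolding I1_def J_def
    using m1 m2 by (subst nn_integral_add; simp only: nn_integral_cmult borel_measurable_times_ennreal borel_measurable_const)
  finally have "ennreal (tail_const DIM('a) s p \<gamma> * ?L) \<le> ennreal (\<rho> powr (s * p)) * (ennreal (b * ?L) * I1 + ennreal b * J)"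
    using tail unfolding q_def by (elim order_trans) (intro mult_left_mono, auto)
  also have "\<dots> = ennreal (b * ?L) * (ennreal (\<rho> powr (s * p)) * I1) + ennreal b * (ennreal (\<rho> powr (s * p)) * J)"
    by (simp add: ring_distribs mult_ac)
  also have "\<dots> \<le> ennreal (b * ?L) * ennreal \<kappa> + ennreal b * (ennreal (\<rho> powr (s * p)) * J)"
  proof (intro add_right_mono mult_left_mono)
    have "ennreal (\<rho> powr (s * p)) * I1 \<le> ennreal (\<rho> powr (s * p)) * ennreal (\<kappa> * \<rho> powr - (s * p))"
      unfolding I1_def q_def \<kappa>_def using \<rho> sp_pos by (intro mult_left_mono kernel_integral_outside_ball) auto
    also have "\<dots> = ennreal \<kappa>"
      using \<rho> \<kappa> by (simp add: ennreal_mult[symmetric] powr_minus field_simps)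
    finally show "ennreal (\<rho> powr (s * p)) * I1 \<le> ennreal \<kappa>" .
  qed simp
  finally have split: "ennreal (tail_const DIM('a) s p \<gamma> * ?L)
      \<le> ennreal (b * ?L * \<kappa>) + ennreal b * (ennreal (\<rho> powr (s * p)) * J)"
    using b \<kappa> by (simp add: ennreal_mult)
  have "tail_const DIM('a) s p \<gamma> * ?L = b * ?L * \<kappa> + b * (M * ?L)"
    by (simp add: tail_const_def b_def \<kappa>_def M_def C_def \<tau>_def q_def algebra_simps)
  then have "ennreal (tail_const DIM('a) s p \<gamma> * ?L) = ennreal (b * ?L * \<kappa>) + ennreal b * ennreal (M * ?L)"
    using b \<kappa> M by (simp add: ennreal_mult[symmetric] ennreal_plus[symmetric] del: ennreal_plus)
  with split have "ennreal b * ennreal (M * ?L) \<le> ennreal b * (ennreal (\<rho> powr (s * p)) * J)"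
    by simp
  then have "ennreal (M * ?L) \<le> ennreal (\<rho> powr (s * p)) * J"
    using b by (subst (asm) ennreal_mult_le_mult_iff) auto
  then have "M * measure lebesgue (sublevel (L / 2) (3 / 4 * \<rho>))
    \<le> 2 * 2 powr q * 4 powr (DIM('a) + p) * C * (unit_ball_vol DIM('a) * \<rho> ^ DIM('a))"
    unfolding q_def C_def using M by (intro sublevel_small_of_large_tail) (auto simp: J_def q_def)
  also have "\<dots> = M * (unit_ball_vol DIM('a) / 2 * (\<rho> * \<tau>) ^ DIM('a))"
    using \<tau> by (simp add: M_def power_mult_distrib)
  finally show "measure lebesgue (sublevel (L / 2) (3 / 4 * \<rho>))
    \<le> unit_ball_vol DIM('a) / 2 * (\<rho> * radius_const DIM('a) s p \<gamma>) ^ DIM('a)"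
    using M by (simp add: \<tau>_def)
qed

end

section \<open>The tail estimate\<close>

theorem theorem7p2:
  fixes s p \<gamma> :: real
  assumes "p > 1" and "0 < s" and "s < 1" and "\<gamma> > 0"
  shows "\<exists>\<eta>::real. 0 < \<eta> \<and> \<eta> < 1 \<and>
    (\<forall>(E :: (real ^ 'n) set) (u :: real ^ 'n \<Rightarrow> real) (x0 :: real ^ 'n) (R :: real) (\<rho> :: real).
       bounded E \<and> open E \<and> u \<in> DG_minus s p E \<gamma> \<and>
       0 < R \<and> ball x0 R \<subseteq> E \<and> (AE x in lebesgue_on (ball x0 R). 0 \<le> u x) \<and>
       0 < \<rho> \<and> ball x0 (2 * \<rho>) \<subseteq> ball x0 R \<longrightarrow>
       ess_inf_on (ball x0 (\<rho> / 2)) u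
         + ereal ((\<rho> / R) powr (s * p / (p - 1))) * enn2ereal (Tail s p (\<lambda>x. neg_part (u x)) x0 R)
       \<ge> ereal \<eta> * enn2ereal (Tail s p (\<lambda>x. pos_part (u x)) x0 \<rho>))"
proof -
  (* The factor 4 powr (p - 1) accounts for L = 4 * k below; the bound on eta says
     that eta powr (p - 1) * H is at most 1, as the comparison of (p - 1)-th powers requires. *)
  define H where "H = tail_const DIM(real ^ 'n) s p \<gamma> * 4 powr (p - 1)"
  define \<eta> where "\<eta> = min (1 / 2) (H powr - (1 / (p - 1)))"
  have H: "0 < H" using tail_const_pos[of s p \<gamma> "DIM(real ^ 'n)"] assms by (simp add: H_def)
  have \<eta>: "0 < \<eta>" "\<eta> < 1" using H by (auto simp: \<eta>_def)
  have "\<eta> powr (p - 1) \<le> (H powr - (1 / (p - 1))) powr (p - 1)"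
    using \<eta> assms by (intro powr_mono2) (auto simp: \<eta>_def)
  also have "\<dots> = 1 / H" using assms H unfolding powr_powr by (simp add: powr_minus_divide)
  finally have \<eta>H: "\<eta> powr (p - 1) * H \<le> 1" using H by (simp add: field_simps)
  show ?thesis
  proof (intro exI[of _ \<eta>] conjI \<eta> allI impI, elim conjE)
    fix E :: "(real ^ 'n) set" and u x0 and R \<rho> :: real
    assume DG: "u \<in> DG_minus s p E \<gamma>" and R: "0 < R" "ball x0 R \<subseteq> E"
      and nonneg: "AE x in lebesgue_on (ball x0 R). 0 \<le> u x"
      and \<rho>: "0 < \<rho>" and sub: "ball x0 (2 * \<rho>) \<subseteq> ball x0 R"
    let ?T = "Tail s p (\<lambda>x. neg_part (u x)) x0 R"
    let ?U = "Tail s p (\<lambda>x. pos_part (u x)) x0 \<rho>"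
    let ?c = "(\<rho> / R) powr (s * p / (p - 1))"
    let ?i = "ess_inf_on (ball x0 (\<rho> / 2)) u"
    have \<rho>R: "2 * \<rho> \<le> R" using sub \<rho> R by (simp add: ball_subset_ball_iff)
    have u: "u \<in> borel_measurable lebesgue" using DG by (simp add: DG_minus_def)
    have nonneg': "AE x in lebesgue. x \<in> ball x0 R \<longrightarrow> 0 \<le> u x"
      using nonneg by (subst (asm) AE_restrict_space_iff) auto
    have ess_inf_ge: "ereal k \<le> ?i" if "AE x in lebesgue. x \<in> ball x0 (\<rho> / 2) \<longrightarrow> k \<le> u x" for k
    proof -
      have "AE x in lebesgue_on (ball x0 (\<rho> / 2)). - ereal (u x) \<le> - ereal k"
        using that by (subst AE_restrict_space_iff) auto
      moreover have "(\<lambda>x. - ereal (u x)) \<in> borel_measurable (lebesgue_on (ball x0 (\<rho> / 2)))"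
        by (intro measurable_restrict_space1 borel_measurable_uminus_ereal borel_measurable_ereal u)
      ultimately have "esssup (lebesgue_on (ball x0 (\<rho> / 2))) (\<lambda>x. - ereal (u x)) \<le> - ereal k"
        by (intro esssup_I) auto
      then show ?thesis unfolding ess_inf_on_def by (metis ereal_minus_le_minus ereal_uminus_uminus)
    qed
    have i0: "0 \<le> ?i"
    proof -
      have "AE x in lebesgue. x \<in> ball x0 (\<rho> / 2) \<longrightarrow> 0 \<le> u x"
        using nonneg' by eventually_elim (use \<rho> \<rho>R in auto)
      from ess_inf_ge[OF this] show ?thesis by (simp add: zero_ereal_def)
    qed
    show "ereal \<eta> * enn2ereal ?U \<le> ?i + ereal ?c * enn2ereal ?T"
    proof (rule ccontr)
      assume "\<not> ?thesis"
      then obtain k where k: "?i + ereal ?c * enn2ereal ?T < ereal k" "ereal k < ereal \<eta> * enn2ereal ?U"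
        using ereal_dense2 by (metis not_le)
      have T0: "0 \<le> ereal ?c * enn2ereal ?T" by simp
      then have "?i < ereal k" using k(1) by (metis add.right_neutral add_left_mono le_less_trans)
      then have k0: "0 < k" using i0 by (metis ereal_less(2) le_less_trans)
      have "ereal ?c * enn2ereal ?T < ereal k" using k(1) i0 by (metis add.left_neutral add_right_mono le_less_trans)
      then have kT: "ennreal ?c * ?T \<le> ennreal k"
        using k0 by (simp add: less_eq_ennreal.rep_eq times_ennreal.rep_eq)
      have kU: "ennreal k \<le> ennreal \<eta> * ?U"
        using k(2) k0 \<eta> by (simp add: less_eq_ennreal.rep_eq times_ennreal.rep_eq)
      interpret DG_minus_on_balls s p \<gamma> E u x0 R \<rho> "4 * k"
      proof
        define I where "I = (\<integral>\<^sup>+x\<in>- ball x0 R.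
          ennreal (neg_part (u x) powr (p - 1) / norm (x - x0) powr (DIM(real ^ 'n) + s * p)) \<partial>lebesgue)"
        have T: "?T = ennpowr (ennreal (R powr (s * p)) * I) (1 / (p - 1))"
          by (simp add: Tail_def I_def del: DIM_cart)
        have "ennpowr (ennreal ?c * ?T) (p - 1) = ennreal (?c powr (p - 1)) * ennpowr ?T (p - 1)"
          using \<rho> R by (intro ennpowr_cmult) simp
        also have "ennpowr ?T (p - 1) = ennreal (R powr (s * p)) * I"
          unfolding T using assms by (intro ennpowr_inverse) simp
        also have "?c powr (p - 1) = (\<rho> / R) powr (s * p)" using assms by (simp add: powr_powr)
        also have "ennreal ((\<rho> / R) powr (s * p)) * (ennreal (R powr (s * p)) * I)
            = ennreal ((\<rho> / R) powr (s * p) * R powr (s * p)) * I"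
          by (simp add: ennreal_mult mult.assoc)
        also have "(\<rho> / R) powr (s * p) * R powr (s * p) = \<rho> powr (s * p)"
          using \<rho> R by (simp add: powr_divide)
        finally have "ennreal (\<rho> powr (s * p)) * I = ennpowr (ennreal ?c * ?T) (p - 1)" ..
        also have "\<dots> \<le> ennpowr (ennreal k) (p - 1)"
          using kT assms by (intro ennpowr_mono) auto
        also have "\<dots> = ennreal (k powr (p - 1))"
          using k0 by (intro ennpowr_ennreal) simp
        also have "\<dots> \<le> ennreal ((4 * k) powr (p - 1))"
          using k0 assms by (intro ennreal_leI powr_mono2) auto
        finally show "ennreal (\<rho> powr (s * p)) * (\<integral>\<^sup>+x\<in>- ball x0 R.
            ennreal (neg_part (u x) powr (p - 1) / norm (x - x0) powr (DIM(real ^ 'n) + s * p)) \<partial>lebesgue)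
            \<le> ennreal ((4 * k) powr (p - 1))"
          unfolding I_def .
      qed (use assms DG R \<rho> \<rho>R nonneg' k0 in auto)
      have "AE x in lebesgue. x \<in> ball x0 (\<rho> / 2) \<longrightarrow> 4 * k / 4 \<le> u x"
      proof (rule lower_bound_of_large_tail)
        let ?J = "ennreal (\<rho> powr (s * p)) *
            (\<integral>\<^sup>+x\<in>- ball x0 \<rho>. ennreal (pos_part (u x) powr (p - 1) / norm (x - x0) powr (DIM(real ^ 'n) + s * p)) \<partial>lebesgue)"
        have U: "?U = ennpowr ?J (1 / (p - 1))"
          by (simp add: Tail_def del: DIM_cart)
        have "ennreal (k powr (p - 1)) = ennpowr (ennreal k) (p - 1)"
          using k0 by (intro ennpowr_ennreal[symmetric]) simp
        also have "\<dots> \<le> ennpowr (ennreal \<eta> * ?U) (p - 1)"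
          using kU assms by (intro ennpowr_mono) auto
        also have "\<dots> = ennreal (\<eta> powr (p - 1)) * ennpowr ?U (p - 1)"
          using \<eta> by (intro ennpowr_cmult)
        also have "ennpowr ?U (p - 1) = ?J"
          unfolding U using assms by (intro ennpowr_inverse) simp
        finally have "ennreal (k powr (p - 1)) \<le> ennreal (\<eta> powr (p - 1)) * ?J" .
        then have "ennreal H * ennreal (k powr (p - 1)) \<le> ennreal H * (ennreal (\<eta> powr (p - 1)) * ?J)"
          by (intro mult_left_mono) auto
        also have "\<dots> = ennreal (\<eta> powr (p - 1) * H) * ?J"
          using H by (simp add: ennreal_mult mult_ac del: DIM_cart)
        also have "\<dots> \<le> ennreal 1 * ?J"
          using \<eta>H by (intro mult_right_mono ennreal_leI) auto
        finally show "ennreal (tail_const DIM(real ^ 'n) s p \<gamma> * (4 * k) powr (p - 1)) \<le> ?J"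
          using H k0 by (simp add: H_def powr_mult ennreal_mult[symmetric] mult.assoc del: DIM_cart)
      qed
      then have "ereal k \<le> ?i" by (intro ess_inf_ge) simp
      with \<open>?i < ereal k\<close> show False by simp
    qed
  qed
qed

end
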